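(* Let $G$ be a path, a cycle, or a wheel (a cycle $C$ together with one extra vertex joined by an edge to every vertex of $C$), and let $u,v\in V(G)$. Form the bunkbed graph $\tilde G$ and let $S\subseteq V(\tilde G)$ be chosen uniformly at random among all subsets of $V(\tilde G)$. Then the probability that there is a path in $\tilde G$ from $u^{(0)}$ to $v^{(0)}$ all of whose vertices lie in $S$ is at least the probability that there is a path in $\tilde G$ from $u^{(0)}$ to $v^{(1)}$ all of whose vertices lie in $S$.
   Context: For a finite simple graph $G$, the bunkbed graph $\tilde G$ consists of two copies $G_0,G_1$ of $G$, with $v^{(i)}$ denoting the copy of $v\in V(G)$ in $G_i$, together with an edge $v^{(0)}v^{(1)}$ for each $v\in V(G)$. *)

theory Defs
  imports "HOL-Probability.Probability" "Graph_Theory.Graph_Theory"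
begin

text \<open>A finite simple graph is a \<open>pair_graph\<close>: a finite, loopfree, symmetric digraph without
  parallel arcs, so that an undirected edge is a pair of opposite arcs.\<close>

definition is_path_graph :: "'a pair_pre_digraph \<Rightarrow> bool" where
  "is_path_graph G \<longleftrightarrow>
    (\<exists>xs. xs \<noteq> [] \<and> distinct xs \<and>
      pverts G = set xs \<and> parcs G = symcl (set (vwalk_arcs xs)))"

definition is_cycle_graph :: "'a pair_pre_digraph \<Rightarrow> bool" where
  "is_cycle_graph G \<longleftrightarrow>
    (\<exists>xs. 3 \<le> length xs \<and> distinct xs \<and>
      pverts G = set xs \<and> parcs G = symcl (set (vwalk_arcs (xs @ [hd xs]))))"

definition is_wheel_graph :: "'a pair_pre_digraph \<Rightarrow> bool" where
  "is_wheel_graph G \<longleftrightarrow>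
    (\<exists>C h. is_cycle_graph C \<and> h \<notin> pverts C \<and>
      pverts G = insert h (pverts C) \<and>
      parcs G = parcs C \<union> symcl ({h} \<times> pverts C))"

text \<open>The copy of \<open>v\<close> in layer \<open>i\<close> is the pair \<open>(v, i)\<close>, with \<open>i\<close> either 0 or 1.\<close>

definition bunkbed :: "'a pair_pre_digraph \<Rightarrow> ('a \<times> nat) pair_pre_digraph" where
  "bunkbed G =
    \<lparr> pverts = pverts G \<times> {0, 1},
      parcs = {((x, i), (y, i)) | x y i. (x, y) \<in> parcs G \<and> i \<in> {0, 1}}
        \<union> symcl {((x, 0), (x, 1)) | x. x \<in> pverts G} \<rparr>"

definition joined_within ::
  "'v pair_pre_digraph \<Rightarrow> 'v set \<Rightarrow> 'v \<Rightarrow> 'v \<Rightarrow> bool" where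
  "joined_within H S x y \<longleftrightarrow>
    (\<exists>p. vpath p (with_proj H) \<and> hd p = x \<and> last p = y \<and> set p \<subseteq> S)"

lemma symcl_iff: "(a, b) \<in> symcl R \<longleftrightarrow> (a, b) \<in> R \<or> (b, a) \<in> R"
  by (force simp: symcl_def)

lemma set_vwalk_arcs_subset: "(a, b) \<in> set (vwalk_arcs xs) \<Longrightarrow> a \<in> set xs \<and> b \<in> set xs"
  by (induct xs rule: vwalk_arcs.induct) auto

lemma vwalk_arcs_distinct: "distinct xs \<Longrightarrow> (a, b) \<in> set (vwalk_arcs xs) \<Longrightarrow> a \<noteq> b"
  by (induct xs rule: vwalk_arcs.induct) auto

lemma vwalk_arcs_snoc:
  "xs \<noteq> [] \<Longrightarrow> set (vwalk_arcs (xs @ [z])) = insert (last xs, z) (set (vwalk_arcs xs))"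
  by (induct xs rule: vwalk_arcs.induct) auto

lemma pair_graphI:
  assumes "finite (pverts G)"
    and "\<And>x y. (x, y) \<in> parcs G \<Longrightarrow> x \<in> pverts G \<and> y \<in> pverts G \<and> x \<noteq> y \<and> (y, x) \<in> parcs G"
  shows "pair_graph G"
proof -
  have "parcs G \<subseteq> pverts G \<times> pverts G" using assms(2) by auto
  then have "finite (parcs G)" using assms(1) finite_subset by blast
  then show ?thesis
    using assms by unfold_locales (auto simp: symmetric_def intro!: symI)
qed

lemma pair_graph_path: "is_path_graph G \<Longrightarrow> pair_graph G"
  unfolding is_path_graph_def
  by (elim exE conjE, rule pair_graphI)
    (auto simp: symcl_iff dest: set_vwalk_arcs_subset vwalk_arcs_distinct)

lemma pair_graph_cycle:
  assumes "is_cycle_graph G"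
  shows "pair_graph G"
proof -
  obtain xs where xs: "3 \<le> length xs" "distinct xs" "pverts G = set xs"
    "parcs G = symcl (set (vwalk_arcs (xs @ [hd xs])))"
    using assms unfolding is_cycle_graph_def by blast
  have ne: "xs \<noteq> []" using xs(1) by auto
  have "hd xs \<noteq> last xs"
    using xs(1,2) ne by (auto simp: hd_conv_nth last_conv_nth nth_eq_iff_index_eq)
  then show ?thesis
    using xs ne
    by (intro pair_graphI)
      (auto simp: symcl_iff vwalk_arcs_snoc dest: set_vwalk_arcs_subset vwalk_arcs_distinct)
qed

lemma pair_graph_wheel:
  assumes "is_wheel_graph G"
  shows "pair_graph G"
proof -
  obtain C h where C: "is_cycle_graph C" "h \<notin> pverts C" "pverts G = insert h (pverts C)"
    "parcs G = parcs C \<union> symcl ({h} \<times> pverts C)"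
    using assms unfolding is_wheel_graph_def by blast
  interpret C: pair_graph C using C(1) by (rule pair_graph_cycle)
  show ?thesis
    using C(2-4) C.pair_finite_verts
    by (intro pair_graphI)
      (auto simp: symcl_iff dest: C.in_arcsD1 C.in_arcsD2 C.no_loops' C.arcs_symmetric)
qed

lemma pair_graph_bunkbed:
  assumes "pair_graph G"
  shows "pair_graph (bunkbed G)"
proof -
  interpret pair_graph G by fact
  show ?thesis
    using pair_finite_verts
    by (intro pair_graphI)
      (auto simp: bunkbed_def symcl_iff dest: in_arcsD1 in_arcsD2 no_loops' arcs_symmetric)
qed

end

theory Submission
  imports Defs
begin

text \<open>Call a vertex of \<open>G\<close> a post of \<open>S\<close> if both of its copies lie in \<open>S\<close>. Fix the set of posts and
  the set of vertices with at least one copy in \<open>S\<close>; within each such class the sets joining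
  \<open>u\<^sup>0\<close> to \<open>v\<^sup>1\<close> are injected into those joining \<open>u\<^sup>0\<close> to \<open>v\<^sup>0\<close>.

  If \<open>F\<close> contains \<open>v\<close> but not \<open>u\<close> and every edge leaving \<open>F\<close> touches a post, then swapping the two
  layers over \<open>F\<close> is such an injection. On a path or a cycle a connection from \<open>u\<close> to \<open>v\<close> runs along
  one of the (at most two) arcs between them; an arc without posts cannot change the layer, and an
  arc with a post can be cut there.

  On a wheel everything is immediate or reduces to these cases unless the hub, \<open>u\<close> and \<open>v\<close> each have
  exactly one copy in \<open>S\<close>. Then every post is joined to the hub, and a hub in layer 1 means that \<open>u\<close>
  reaches a post inside layer 0. Let \<open>\<phi>\<close> swap the layers away from \<open>u\<close> and \<open>v\<close>. If both \<open>S\<close>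
  and \<open>\<phi> S\<close> join \<open>u\<^sup>0\<close> to \<open>v\<^sup>1\<close>, swapping \<open>v\<close> alone keeps \<open>S\<close> connected through two posts; otherwise
  there is freedom to move the hub to layer 0, where it is adjacent to both endpoints.\<close>

section \<open>Connections in a bunkbed graph\<close>

text \<open>Reachability in the bunkbed graph, with vertex and layer as separate arguments so that
  layers can be altered while the walk in the base graph is kept. Walks may repeat vertices, and
  edge set and vertex set vary independently.\<close>

inductive conn :: "('a \<times> 'a) set \<Rightarrow> ('a \<times> nat) set \<Rightarrow> 'a \<Rightarrow> nat \<Rightarrow> 'a \<Rightarrow> nat \<Rightarrow> bool"
  for E S u a where
  base: "(u, a) \<in> S \<Longrightarrow> conn E S u a u a"
| along: "conn E S u a x i \<Longrightarrow> (x, y) \<in> E \<Longrightarrow> (y, i) \<in> S \<Longrightarrow> conn E S u a y i"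
| across: "conn E S u a x i \<Longrightarrow> (x, j) \<in> S \<Longrightarrow> conn E S u a x j"

lemma conn_end: "conn E S u a x i \<Longrightarrow> (x, i) \<in> S"
  by (induction rule: conn.induct) auto

lemma conn_start: "conn E S u a x i \<Longrightarrow> (u, a) \<in> S"
  by (induction rule: conn.induct) auto

lemma conn_trans:
  assumes "conn E S y j z k" "conn E S x i y j"
  shows "conn E S x i z k"
  using assms by (induction rule: conn.induct) (auto intro: conn.intros)

lemma conn_sym:
  assumes "conn E S u a x i" "sym E"
  shows "conn E S x i u a"
  using assms(1)
proof (induction rule: conn.induct)
  case base
  then show ?case by (rule conn.base)
next
  case (along x i y)
  have "conn E S y i x i"
    using along assms(2) by (meson conn.base conn.along conn_end symD)
  with along.IH show ?case by (rule conn_trans)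
next
  case (across x i j)
  have "conn E S x j x i"
    using across by (meson conn.base conn.across conn_end)
  with across.IH show ?case by (rule conn_trans)
qed

lemma conn_mono:
  assumes "conn E S u a x i" "S \<subseteq> R"
  shows "conn E R u a x i"
  using assms(1)
  by (induction rule: conn.induct) (use assms(2) in \<open>auto intro: conn.intros\<close>)

text \<open>A walk uses only edges between vertices having a copy in \<open>S\<close>. This is what
  removes the spokes of a wheel when the hub has no copy in \<open>S\<close>.\<close>

lemma conn_restrict_edges:
  assumes "conn E S u a x i" "\<And>x y i j. (x, y) \<in> E \<Longrightarrow> (x, i) \<in> S \<Longrightarrow> (y, j) \<in> S \<Longrightarrow> (x, y) \<in> E'"
  shows "conn E' S u a x i"
  using assms(1)
proof (induction rule: conn.induct)
  case (along x i y)
  then show ?case using assms(2)[of x y i i] by (auto intro: conn.along dest: conn_end)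
qed (auto intro: conn.intros)

lemma conn_mono_edges:
  assumes "conn E S u a x i" "E \<subseteq> E'"
  shows "conn E' S u a x i"
  using assms(1) by (rule conn_restrict_edges) (use assms(2) in auto)

text \<open>Forgetting the layers turns \<open>across\<close> steps into pauses, so the walk can be
  replayed inside the single layer \<open>b\<close>.\<close>

lemma conn_project:
  assumes "conn E S u a x i" "\<And>y i. (y, i) \<in> S \<Longrightarrow> (y, b) \<in> R"
  shows "conn E R u b x b"
  using assms(1) by (induction rule: conn.induct) (auto intro: conn.intros assms(2))

section \<open>Reachability and simple paths\<close>

lemma conn_vwalk:
  assumes "p \<noteq> []" "set p \<subseteq> S" "set (vwalk_arcs p) \<subseteq> parcs (bunkbed G)" "hd p = (u, a)"
  shows "conn (parcs G) S u a (fst (last p)) (snd (last p))"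
  using assms
proof (induction p rule: rev_induct)
  case (snoc z p)
  show ?case
  proof (cases "p = []")
    case True
    then show ?thesis using snoc.prems by (auto intro: conn.base)
  next
    case False
    then have IH: "conn (parcs G) S u a (fst (last p)) (snd (last p))"
      using snoc by (auto simp: vwalk_arcs_snoc)
    have "(last p, z) \<in> parcs (bunkbed G)" "z \<in> S"
      using snoc.prems False by (auto simp: vwalk_arcs_snoc)
    then show ?thesis
      using conn.along[OF IH] conn.across[OF IH]
      by (auto simp: bunkbed_def symcl_iff)
  qed
qed simp

lemma vwalk_arcs_join:
  "set (vwalk_arcs (xs @ y # ys)) = set (vwalk_arcs (xs @ [y])) \<union> set (vwalk_arcs (y # ys))"
  by (induction xs rule: vwalk_arcs.induct) auto

text \<open>Appending \<open>z\<close> could repeat a vertex; if \<open>z\<close> already lies on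
  \<open>p\<close>, the initial segment of \<open>p\<close> ending at \<open>z\<close> is taken
  instead.\<close>

lemma vpath_extend:
  assumes "set p \<subseteq> S" "vpath p (with_proj H)" "hd p = x" "last p = y"
    and "(y, z) \<in> parcs H" "z \<in> S" "z \<in> pverts H"
  shows "\<exists>q. vpath q (with_proj H) \<and> hd q = x \<and> last q = z \<and> set q \<subseteq> S"
proof (cases "z \<in> set p")
  case True
  then obtain q r where p: "p = (q @ [z]) @ r"
    by (metis append.assoc append_Cons append_Nil in_set_conv_decomp)
  then have "set (vwalk_arcs (q @ [z])) \<subseteq> set (vwalk_arcs p)"
    using vwalk_arcs_join[of q z r] by simp
  then have "vpath (q @ [z]) (with_proj H)"
    using assms(2) p by (auto simp: vpath_def vwalk_def)
  moreover have "hd (q @ [z]) = x" using assms(3) p by (cases q) auto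
  ultimately show ?thesis using assms(1) p by (intro exI[of _ "q @ [z]"]) auto
next
  case False
  then show ?thesis
    using assms by (intro exI[of _ "p @ [z]"]) (auto simp: vpath_def vwalk_def vwalk_arcs_snoc)
qed

lemma joined_within_conv_conn:
  assumes "S \<subseteq> pverts G \<times> {0, 1}"
  shows "joined_within (bunkbed G) S (u, a) (v, b) \<longleftrightarrow> conn (parcs G) S u a v b"
proof
  assume "joined_within (bunkbed G) S (u, a) (v, b)"
  then obtain p where "vpath p (with_proj (bunkbed G))" "hd p = (u, a)" "last p = (v, b)" "set p \<subseteq> S"
    unfolding joined_within_def by blast
  then show "conn (parcs G) S u a v b"
    using conn_vwalk[of p S G u a] by (auto simp: vpath_def vwalk_def)
next
  assume "conn (parcs G) S u a v b"
  then show "joined_within (bunkbed G) S (u, a) (v, b)"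
  proof (induction rule: conn.induct)
    case base
    then show ?case
      using assms unfolding joined_within_def
      by (intro exI[of _ "[(u, a)]"]) (auto simp: vpath_def vwalk_def bunkbed_def)
  next
    case (along x i y)
    then have "((x, i), (y, i)) \<in> parcs (bunkbed G)" "(y, i) \<in> pverts (bunkbed G)"
      using assms by (auto simp: bunkbed_def)
    then show ?case
      using along unfolding joined_within_def by (blast intro: vpath_extend)
  next
    case (across x i j)
    have xi: "(x, i) \<in> S" using across.hyps(1) by (rule conn_end)
    \<comment> \<open>An \<open>across\<close> step with \<open>i = j\<close> is permitted but
      corresponds to no edge of the bunkbed graph, so it is treated apart.\<close>
    show ?case
    proof (cases "i = j")
      case True
      then show ?thesis using across.IH by simp
    next
      case False
      then have "((x, i), (x, j)) \<in> parcs (bunkbed G)" "(x, j) \<in> pverts (bunkbed G)"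
        using assms xi across.hyps(2) by (auto simp: bunkbed_def symcl_iff)
      then show ?thesis
        using across unfolding joined_within_def by (blast intro: vpath_extend)
    qed
  qed
qed

section \<open>Swapping layers\<close>

definition posts :: "('a \<times> nat) set \<Rightarrow> 'a set" where
  "posts S = {x. (x, 0) \<in> S \<and> (x, 1) \<in> S}"

text \<open>On layers 0 and 1 the map \<open>1 - i\<close> is the swap. The bound
  \<open>i \<le> 1\<close> is there because truncated subtraction sends every larger
  \<open>i\<close> to 0 as well.\<close>

definition flip :: "'a set \<Rightarrow> ('a \<times> nat) set \<Rightarrow> ('a \<times> nat) set" where
  "flip F S = {(x, i). i \<le> 1 \<and> (x, if x \<in> F then 1 - i else i) \<in> S}"

lemma layer_cases: "S \<subseteq> V \<times> {0, 1} \<Longrightarrow> (x, i) \<in> S \<Longrightarrow> i = 0 \<or> i = (1::nat)"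
  by auto

lemma flip_subset: "S \<subseteq> V \<times> {0, 1} \<Longrightarrow> flip F S \<subseteq> V \<times> {0, 1}"
  by (auto simp: flip_def split: if_splits)

lemma flip_flip: "S \<subseteq> V \<times> {0, 1} \<Longrightarrow> flip F (flip F S) = S"
  by (auto simp: flip_def split: if_splits)

lemma inj_on_flip: "inj_on (flip F) {S. S \<subseteq> V \<times> {0, 1}}"
  by (rule inj_on_inverseI[where g = "flip F"]) (auto simp: flip_flip)

lemma posts_flip [simp]: "posts (flip F S) = posts S"
  by (auto simp: posts_def flip_def)

lemma support_flip:
  assumes "S \<subseteq> V \<times> {0, 1}"
  shows "fst ` flip F S = fst ` S"
proof -
  have "fst ` flip F R \<subseteq> fst ` R" for R :: "('a \<times> nat) set"
    by (force simp: flip_def split: if_splits)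
  from this[of S] this[of "flip F S"] show ?thesis
    unfolding flip_flip[OF assms] by blast
qed

text \<open>The walk is carried over step by step. Only an edge crossing the boundary of
  \<open>F\<close> asks for a change of layer, and the change is made at the post which that edge
  touches. As \<open>u\<close> is outside \<open>F\<close>, the start stays in layer 0.\<close>

lemma conn_flip:
  assumes S: "S \<subseteq> V \<times> {0, 1}" and u: "u \<notin> F"
    and cut: "\<And>x y. (x, y) \<in> E \<Longrightarrow> (x \<in> F) \<noteq> (y \<in> F) \<Longrightarrow> x \<in> posts S \<or> y \<in> posts S"
    and conn: "conn E S u 0 x i"
  shows "conn E (flip F S) u 0 x (if x \<in> F then 1 - i else i)"
  using conn
proof (induction rule: conn.induct)
  case base
  then show ?case using u by (auto intro!: conn.base simp: flip_def)
next
  case (along x i y)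
  let ?s = "\<lambda>x. if x \<in> F then 1 - i else i"
  have i: "i = 0 \<or> i = 1" using layer_cases[OF S along.hyps(3)] .
  have y: "(y, ?s y) \<in> flip F S" using along.hyps(3) i by (auto simp: flip_def)
  show ?case
  proof (cases "?s x = ?s y")
    case True
    then show ?thesis using conn.along[OF along.IH along.hyps(2)] y by simp
  next
    case False
    then have "(x \<in> F) \<noteq> (y \<in> F)" by metis
    then consider "x \<in> posts S" | "y \<in> posts S" using cut[OF along.hyps(2)] by blast
    then show ?thesis
    proof cases
      case 1
      then have "(x, ?s y) \<in> flip F S" using i by (auto simp: flip_def posts_def)
      from conn.across[OF along.IH this] show ?thesis using along.hyps(2) y by (rule conn.along)
    next
      case 2
      then have "(y, ?s x) \<in> flip F S" using i by (auto simp: flip_def posts_def)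
      from conn.along[OF along.IH along.hyps(2) this] show ?thesis using y by (rule conn.across)
    qed
  qed
next
  case (across x i j)
  have "j = 0 \<or> j = 1" using layer_cases[OF S across.hyps(2)] .
  then have "(x, if x \<in> F then 1 - j else j) \<in> flip F S"
    using across.hyps(2) by (auto simp: flip_def)
  with across.IH show ?case by (rule conn.across)
qed

section \<open>Comparing cardinalities class by class\<close>

text \<open>Layer swaps preserve both the posts \<open>T\<close> and the support \<open>D\<close>.
  Fixing these gives classes on each of which one fixed set \<open>F\<close> can be swapped.\<close>

definition joining :: "'a set \<Rightarrow> ('a \<times> 'a) set \<Rightarrow> 'a \<Rightarrow> 'a \<Rightarrow> nat \<Rightarrow> 'a set \<Rightarrow> 'a set
    \<Rightarrow> ('a \<times> nat) set set" where
  "joining V E u v j T D = {S. S \<subseteq> V \<times> {0, 1} \<and> conn E S u 0 v j \<and> posts S = T \<and> fst ` S = D}"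

text \<open>Each fibre may have its own injection: since the injections preserve \<open>key\<close>,
  images of different fibres are disjoint and the injections glue together.\<close>

lemma card_le_fibrewise:
  fixes key :: "'b \<Rightarrow> 'k"
  assumes "finite B"
    and "\<And>k. \<exists>g. inj_on g {x \<in> A. key x = k} \<and> g ` {x \<in> A. key x = k} \<subseteq> {y \<in> B. key y = k}"
  shows "card A \<le> card B"
proof -
  have "\<exists>g. \<forall>k. inj_on (g k) {x \<in> A. key x = k} \<and>
      g k ` {x \<in> A. key x = k} \<subseteq> {y \<in> B. key y = k}"
    by (intro choice allI assms(2))
  then obtain g where g: "\<And>k. inj_on (g k) {x \<in> A. key x = k}"
    "\<And>k. g k ` {x \<in> A. key x = k} \<subseteq> {y \<in> B. key y = k}"
    by blast
  have gB: "g (key x) x \<in> B" "key (g (key x) x) = key x" if "x \<in> A" for x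
    using g(2)[of "key x"] that by auto
  have "inj_on (\<lambda>x. g (key x) x) A"
  proof (rule inj_onI)
    fix x y assume xy: "x \<in> A" "y \<in> A" "g (key x) x = g (key y) y"
    then have "key x = key y" using gB(2) by metis
    then show "x = y" using inj_onD[OF g(1)[of "key x"]] xy by auto
  qed
  then show ?thesis using gB(1) assms(1) by (intro card_inj_on_le) auto
qed

definition injects :: "'a set \<Rightarrow> ('a \<times> 'a) set \<Rightarrow> 'a \<Rightarrow> 'a \<Rightarrow> 'a set \<Rightarrow> 'a set \<Rightarrow> bool" where
  "injects V E u v T D \<longleftrightarrow>
    (\<exists>g. inj_on g (joining V E u v 1 T D) \<and> g ` joining V E u v 1 T D \<subseteq> joining V E u v 0 T D)"

lemma card_joining_le:
  assumes "finite V" and "\<And>T D. injects V E u v T D"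
  shows "card {S. S \<subseteq> V \<times> {0, 1} \<and> conn E S u 0 v 1} \<le> card {S. S \<subseteq> V \<times> {0, 1} \<and> conn E S u 0 v 0}"
    (is "card (?A 1) \<le> card (?A 0)")
proof (rule card_le_fibrewise[where key = "\<lambda>S. (posts S, fst ` S)"])
  show "finite (?A 0)" using assms(1) by (auto intro: finite_subset[where B = "Pow (V \<times> {0, 1})"])
next
  fix k :: "'a set \<times> 'a set"
  have "{S \<in> ?A j. (posts S, fst ` S) = k} = joining V E u v j (fst k) (snd k)" for j
    by (cases k) (auto simp: joining_def)
  then show "\<exists>g. inj_on g {S \<in> ?A 1. (posts S, fst ` S) = k} \<and>
      g ` {S \<in> ?A 1. (posts S, fst ` S) = k} \<subseteq> {S \<in> ?A 0. (posts S, fst ` S) = k}"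
    using assms(2) unfolding injects_def by simp
qed

text \<open>A swap is an involution that stays within its class, so only the connection in the image
  has to be checked.\<close>

lemma injects_by_flip:
  assumes "\<And>S. S \<in> joining V E u v 1 T D \<Longrightarrow> conn E (flip F S) u 0 v 0"
  shows "injects V E u v T D"
  unfolding injects_def
proof (intro exI[of _ "flip F"] conjI)
  show "inj_on (flip F) (joining V E u v 1 T D)"
    by (rule inj_on_subset[OF inj_on_flip[where V = V]]) (auto simp: joining_def)
  show "flip F ` joining V E u v 1 T D \<subseteq> joining V E u v 0 T D"
  proof safe
    fix S assume S: "S \<in> joining V E u v 1 T D"
    then have "S \<subseteq> V \<times> {0, 1}" by (simp add: joining_def)
    from flip_subset[OF this] support_flip[OF this] assms[OF S] S
    show "flip F S \<in> joining V E u v 0 T D" by (simp add: joining_def)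
  qed
qed

section \<open>Cuts at posts\<close>

definition cut :: "('a \<times> 'a) set \<Rightarrow> 'a set \<Rightarrow> 'a \<Rightarrow> 'a \<Rightarrow> 'a set \<Rightarrow> bool" where
  "cut E T u v F \<longleftrightarrow> v \<in> F \<and> u \<notin> F \<and>
    (\<forall>x y. (x, y) \<in> E \<longrightarrow> (x \<in> F) \<noteq> (y \<in> F) \<longrightarrow> x \<in> T \<or> y \<in> T)"

lemma cut_complement: "cut E T u v F \<Longrightarrow> cut E T v u (- F)"
  by (auto simp: cut_def)

lemma conn_flip_cut:
  assumes "cut E (posts S) u v F" "S \<subseteq> V \<times> {0, 1}" "conn E S u 0 v 1"
  shows "conn E (flip F S) u 0 v 0"
  using conn_flip[OF assms(2) _ _ assms(3), of F] assms(1) by (auto simp: cut_def)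

lemma injects_by_cut: "cut E T u v F \<Longrightarrow> injects V E u v T D"
  by (rule injects_by_flip[of _ _ _ _ _ _ F]) (auto simp: joining_def intro!: conn_flip_cut)

lemma injects_refl: "injects V E u u T D"
  by (rule injects_by_flip[of _ _ _ _ _ _ "{}"])
    (auto simp: joining_def flip_def intro!: conn.base dest: conn_start)

section \<open>Paths and cycles\<close>

lemma conn_parallel:
  assumes conn: "conn (E1 \<union> E2) S u 0 x i" and S: "S \<subseteq> V \<times> {0, 1}"
    and sub: "E1 \<subseteq> V1 \<times> V1" "E2 \<subseteq> V2 \<times> V2" "V1 \<inter> V2 \<subseteq> {u, v}"
    and v1: "(v, 1) \<in> S"
  shows "conn E1 S u 0 v 1 \<or> conn E2 S u 0 v 1 \<or>
    x \<in> insert u V1 \<and> conn E1 S u 0 x i \<or> x \<in> insert u V2 \<and> conn E2 S u 0 x i"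
  using conn
proof (induction rule: conn.induct)
  case base
  then show ?case by (auto intro: conn.base)
next
  case (along x i y)
  have xi: "(x, i) \<in> S" using along.hyps(1) by (rule conn_end)
  have u0: "(u, 0) \<in> S" using along.hyps(1) by (rule conn_start)
  have to_u: "conn E' S u 0 u i" if "x = u" for E'
    using that xi u0 by (metis conn.base conn.across)
  have to_v: "conn E' S u 0 v 1" if "x = v" "conn E' S u 0 x i" for E'
    using that v1 by (metis conn.across)
  have step: "conn E' S u 0 x i \<Longrightarrow> (x, y) \<in> E' \<Longrightarrow> conn E' S u 0 y i" for E'
    using along.hyps(3) by (rule conn.along[rotated 2])
  from along.hyps(2) consider "(x, y) \<in> E1" "x \<in> V1" "y \<in> V1" | "(x, y) \<in> E2" "x \<in> V2" "y \<in> V2"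
    using sub by auto
  then show ?case
  proof cases
    case 1
    then show ?thesis using along.IH to_u to_v step sub(3) by blast
  next
    case 2
    then show ?thesis using along.IH to_u to_v step sub(3) by blast
  qed
next
  case (across x i j)
  then show ?case by (blast intro: conn.across)
qed

text \<open>Layers can be changed only at a post, and the edges never lead out of
  \<open>W\<close>.\<close>

lemma conn_no_posts:
  assumes "conn E S u 0 x i" "S \<subseteq> V \<times> {0, 1}" "posts S \<inter> W = {}" "u \<in> W" "E \<subseteq> W \<times> W"
  shows "x \<in> W \<and> i = 0"
  using assms(1)
proof (induction rule: conn.induct)
  case (across x i j)
  then have "(x, 0) \<in> S" "x \<notin> posts S" using assms(3) by (auto dest: conn_end)
  then show ?case using across layer_cases[OF assms(2) across.hyps(2)] by (auto simp: posts_def)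
qed (use assms in auto)

text \<open>Cuts of the two sides agree at \<open>u\<close> and \<open>v\<close>, the only possible
  common vertices, and so merge into one \<open>F\<close>. The connection runs within one side, and
  that side contains a post because the layer changes; hence its cut is available.\<close>

lemma injects_parallel:
  assumes sub: "E1 \<subseteq> V1 \<times> V1" "E2 \<subseteq> V2 \<times> V2" "V1 \<inter> V2 \<subseteq> {u, v}"
    and V: "u \<in> V1" "v \<in> V1" "u \<in> V2" "v \<in> V2" "u \<noteq> v"
    and cut1: "T \<inter> V1 \<noteq> {} \<Longrightarrow> \<exists>F. cut E1 T u v F"
    and cut2: "T \<inter> V2 \<noteq> {} \<Longrightarrow> \<exists>F. cut E2 T u v F"
  shows "injects V (E1 \<union> E2) u v T D"
proof -
  \<comment> \<open>Without a post in \<open>V1\<close> there need not be a cut; the set chosen then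
    still has to contain \<open>v\<close> and avoid \<open>u\<close>, so that it fits with the other
    side.\<close>
  have "\<exists>F. v \<in> F \<and> u \<notin> F \<and> (T \<inter> V1 \<noteq> {} \<longrightarrow> cut E1 T u v F)"
    using cut1 V(5) unfolding cut_def by (cases "T \<inter> V1 = {}") blast+
  then obtain F1 where F1: "v \<in> F1" "u \<notin> F1" "T \<inter> V1 \<noteq> {} \<Longrightarrow> cut E1 T u v F1" by blast
  have "\<exists>F. v \<in> F \<and> u \<notin> F \<and> (T \<inter> V2 \<noteq> {} \<longrightarrow> cut E2 T u v F)"
    using cut2 V(5) unfolding cut_def by (cases "T \<inter> V2 = {}") blast+
  then obtain F2 where F2: "v \<in> F2" "u \<notin> F2" "T \<inter> V2 \<noteq> {} \<Longrightarrow> cut E2 T u v F2" by blast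
  define F where "F = F1 \<inter> V1 \<union> F2 \<inter> V2"
  have F_V1: "x \<in> F \<longleftrightarrow> x \<in> F1" if "x \<in> V1" for x
    using that sub(3) F1 F2 V by (auto simp: F_def)
  have F_V2: "x \<in> F \<longleftrightarrow> x \<in> F2" if "x \<in> V2" for x
    using that sub(3) F1 F2 V by (auto simp: F_def)
  have c1: "cut E1 T u v F" if "T \<inter> V1 \<noteq> {}"
    using F1(3)[OF that] sub(1) V F_V1 unfolding cut_def by blast
  have c2: "cut E2 T u v F" if "T \<inter> V2 \<noteq> {}"
    using F2(3)[OF that] sub(2) V F_V2 unfolding cut_def by blast
  show ?thesis
  proof (rule injects_by_flip[of _ _ _ _ _ _ F])
    fix S assume "S \<in> joining V (E1 \<union> E2) u v 1 T D"
    then have S: "S \<subseteq> V \<times> {0, 1}" "conn (E1 \<union> E2) S u 0 v 1" "posts S = T"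
      by (auto simp: joining_def)
    from conn_parallel[OF S(2,1) sub conn_end[OF S(2)]]
    consider "conn E1 S u 0 v 1" | "conn E2 S u 0 v 1" by blast
    then show "conn (E1 \<union> E2) (flip F S) u 0 v 0"
    proof cases
      case 1
      then have "T \<inter> V1 \<noteq> {}" using conn_no_posts[OF 1 S(1) _ V(1) sub(1)] S(3) by auto
      from conn_flip_cut[OF _ S(1) 1] c1[OF this] S(3) show ?thesis
        by (auto intro: conn_mono_edges)
    next
      case 2
      then have "T \<inter> V2 \<noteq> {}" using conn_no_posts[OF 2 S(1) _ V(3) sub(2)] S(3) by auto
      from conn_flip_cut[OF _ S(1) 2] c2[OF this] S(3) show ?thesis
        by (auto intro: conn_mono_edges)
    qed
  qed
qed

lemma symcl_vwalk_arcs_subset: "symcl (set (vwalk_arcs xs)) \<subseteq> set xs \<times> set xs"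
  by (auto simp: symcl_iff dest: set_vwalk_arcs_subset)

lemma symcl_Un: "symcl (A \<union> B) = symcl A \<union> symcl B"
  by (auto simp: symcl_iff)

text \<open>If the post is \<open>a\<close>, the complement of \<open>a\<close> is a cut. Otherwise
  the arc is cut at \<open>t\<close>: the final stretch from \<open>t\<close> to \<open>b\<close> is
  left only through edges at \<open>t\<close>.\<close>

lemma cut_arc:
  assumes d: "distinct (a # A @ [b])" and t: "t \<in> T" "t \<in> set (a # A @ [b])"
  shows "\<exists>F. cut (symcl (set (vwalk_arcs (a # A @ [b])))) T a b F"
proof (cases "t = a")
  case True
  have "cut (symcl (set (vwalk_arcs (a # A @ [b])))) T a b (- {a})"
    using d t(1) True unfolding cut_def by auto
  then show ?thesis by blast
next
  case False
  then obtain P Q where PQ: "A @ [b] = P @ t # Q" using t by (auto dest!: split_list)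
  let ?F = "set (t # Q)"
  have arcs: "set (vwalk_arcs (a # A @ [b])) =
      set (vwalk_arcs (a # P @ [t])) \<union> set (vwalk_arcs (t # Q))"
    using vwalk_arcs_join[of "a # P" t Q] PQ by simp
  have "b = last (t # Q)" by (metis PQ last_appendR last_snoc list.distinct(1))
  then have b: "b \<in> ?F" by (metis last_in_set list.distinct(1))
  have d': "distinct (a # P @ t # Q)" using d PQ by simp
  have touch: "x \<in> T \<or> y \<in> T" if "(x, y) \<in> set (vwalk_arcs (a # A @ [b]))" "(x \<in> ?F) \<noteq> (y \<in> ?F)" for x y
  proof -
    have "(x, y) \<notin> set (vwalk_arcs (t # Q))"
      using that(2) set_vwalk_arcs_subset by metis
    then have "(x, y) \<in> set (vwalk_arcs (a # P @ [t]))" using that(1) arcs by blast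
    then have "x \<in> set (a # P @ [t])" "y \<in> set (a # P @ [t])"
      using set_vwalk_arcs_subset by metis+
    then have "x = t \<or> y = t" using that(2) d' by auto
    then show ?thesis using t(1) by blast
  qed
  have "cut (symcl (set (vwalk_arcs (a # A @ [b])))) T a b ?F"
    unfolding cut_def symcl_iff
  proof (intro conjI allI impI)
    show "a \<notin> ?F" using d' by auto
    fix x y
    assume "(x, y) \<in> set (vwalk_arcs (a # A @ [b])) \<or> (y, x) \<in> set (vwalk_arcs (a # A @ [b]))"
      and "(x \<in> ?F) \<noteq> (y \<in> ?F)"
    then show "x \<in> T \<or> y \<in> T" using touch[of x y] touch[of y x] by argo
  qed (rule b)
  then show ?thesis by blast
qed

lemma cut_arc':
  assumes "distinct (a # A @ [b])" "T \<inter> set (a # A @ [b]) \<noteq> {}" "{u, v} = {a, b}" "u \<noteq> v"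
  shows "\<exists>F. cut (symcl (set (vwalk_arcs (a # A @ [b])))) T u v F"
proof -
  obtain F where "cut (symcl (set (vwalk_arcs (a # A @ [b])))) T a b F"
    using assms(1,2) cut_arc by (metis disjoint_iff)
  moreover have "u = a \<and> v = b \<or> u = b \<and> v = a" using assms(3,4) by (auto simp: doubleton_eq_iff)
  ultimately show ?thesis using cut_complement by metis
qed

lemma split_list_two:
  assumes "u \<in> set xs" "v \<in> set xs" "u \<noteq> v"
  obtains P a A b Q where "xs = P @ a # A @ b # Q" "{u, v} = {a, b}"
proof -
  obtain P R where xs: "xs = P @ u # R" using assms(1) by (auto dest: split_list)
  show thesis
  proof (cases "v \<in> set R")
    case True
    then obtain A Q where "R = A @ v # Q" by (auto dest: split_list)
    with xs show thesis by (intro that[of P u A v Q]) auto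
  next
    case False
    then have "v \<in> set P" using xs assms by auto
    then obtain P' A where "P = P' @ v # A" by (auto dest: split_list)
    with xs show thesis by (intro that[of P' v A u R]) auto
  qed
qed

lemma injects_path:
  assumes "is_path_graph G" "u \<in> pverts G" "v \<in> pverts G"
  shows "injects V (parcs G) u v T D"
proof (cases "u = v")
  case True
  then show ?thesis by (simp add: injects_refl)
next
  case uv: False
  obtain xs where xs: "distinct xs" "pverts G = set xs" "parcs G = symcl (set (vwalk_arcs xs))"
    using assms(1) unfolding is_path_graph_def by blast
  obtain P a A b Q where ab: "xs = P @ a # A @ b # Q" "{u, v} = {a, b}"
    using split_list_two assms xs(2) uv by metis
  let ?E1 = "symcl (set (vwalk_arcs (a # A @ [b])))"
  \<comment> \<open>The second side consists of the two tails beyond \<open>a\<close> and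
    \<open>b\<close>, which no edge joins to each other.\<close>
  let ?E2 = "symcl (set (vwalk_arcs (P @ [a])) \<union> set (vwalk_arcs (b # Q)))"
  have "set (vwalk_arcs (P @ a # A @ b # Q)) =
      set (vwalk_arcs (P @ [a])) \<union> set (vwalk_arcs (a # A @ b # Q))"
    by (rule vwalk_arcs_join)
  moreover have "set (vwalk_arcs (a # A @ b # Q)) =
      set (vwalk_arcs (a # A @ [b])) \<union> set (vwalk_arcs (b # Q))"
    using vwalk_arcs_join[of "a # A" b Q] by (simp only: append_Cons)
  ultimately have "set (vwalk_arcs xs) =
      set (vwalk_arcs (a # A @ [b])) \<union> (set (vwalk_arcs (P @ [a])) \<union> set (vwalk_arcs (b # Q)))"
    by (simp only: ab(1) Un_ac)
  then have "parcs G = ?E1 \<union> ?E2" unfolding xs(3) symcl_Un[symmetric] by (rule arg_cong)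
  moreover have "injects V (?E1 \<union> ?E2) u v T D"
  proof (rule injects_parallel)
    show "?E1 \<subseteq> set (a # A @ [b]) \<times> set (a # A @ [b])" by (rule symcl_vwalk_arcs_subset)
    show "?E2 \<subseteq> set (P @ a # b # Q) \<times> set (P @ a # b # Q)"
      unfolding symcl_Un by (intro Un_least order_trans[OF symcl_vwalk_arcs_subset]) auto
    show "set (a # A @ [b]) \<inter> set (P @ a # b # Q) \<subseteq> {u, v}"
      using xs(1) ab by auto
    show "u \<in> set (a # A @ [b])" "v \<in> set (a # A @ [b])"
      "u \<in> set (P @ a # b # Q)" "v \<in> set (P @ a # b # Q)"
      using ab(2) by auto
    show "u \<noteq> v" by fact
    show "\<exists>F. cut ?E1 T u v F" if "T \<inter> set (a # A @ [b]) \<noteq> {}"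
      using that xs(1) ab uv by (intro cut_arc') auto
    \<comment> \<open>The tail at \<open>b\<close> has no boundary edges in \<open>?E2\<close>, so
      it is a cut whatever the posts are.\<close>
    have "x \<in> set (b # Q) \<longleftrightarrow> y \<in> set (b # Q)" if "(x, y) \<in> ?E2" for x y
    proof -
      have "(x, y) \<in> set (P @ [a]) \<times> set (P @ [a]) \<union> set (b # Q) \<times> set (b # Q)"
        using that symcl_vwalk_arcs_subset unfolding symcl_Un by blast
      then show ?thesis using xs(1) ab(1) by auto
    qed
    then have "cut ?E2 T a b (set (b # Q))"
      using xs(1) ab(1) unfolding cut_def by auto
    moreover have "u = a \<and> v = b \<or> u = b \<and> v = a" using ab(2) uv by (auto simp: doubleton_eq_iff)
    ultimately show "\<exists>F. cut ?E2 T u v F" using cut_complement by metis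
  qed
  ultimately show ?thesis by simp
qed

lemma injects_cycle:
  assumes "is_cycle_graph G" "u \<in> pverts G" "v \<in> pverts G"
  shows "injects V (parcs G) u v T D"
proof (cases "u = v")
  case True
  then show ?thesis by (simp add: injects_refl)
next
  case uv: False
  obtain xs where xs: "distinct xs" "pverts G = set xs"
    "parcs G = symcl (set (vwalk_arcs (xs @ [hd xs])))"
    using assms(1) unfolding is_cycle_graph_def by blast
  obtain P a A b Q where ab: "xs = P @ a # A @ b # Q" "{u, v} = {a, b}"
    using split_list_two assms xs(2) uv by metis
  let ?E1 = "symcl (set (vwalk_arcs (a # A @ [b])))"
  \<comment> \<open>The other arc of the cycle runs from \<open>b\<close> through \<open>Q\<close>,
    closes up at \<open>hd xs\<close>, and returns through \<open>P\<close> to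
    \<open>a\<close>.\<close>
  let ?E2 = "symcl (set (vwalk_arcs (b # (Q @ P) @ [a])))"
  let ?z = "hd xs"
  have "set (vwalk_arcs (P @ a # A @ b # Q @ [?z])) =
      set (vwalk_arcs (P @ [a])) \<union> set (vwalk_arcs (a # A @ b # Q @ [?z]))"
    by (rule vwalk_arcs_join)
  moreover have "set (vwalk_arcs (a # A @ b # Q @ [?z])) =
      set (vwalk_arcs (a # A @ [b])) \<union> set (vwalk_arcs (b # Q @ [?z]))"
    using vwalk_arcs_join[of "a # A" b "Q @ [?z]"] by (simp only: append_Cons)
  moreover have "set (vwalk_arcs (b # (Q @ P) @ [a])) =
      set (vwalk_arcs (b # Q @ [?z])) \<union> set (vwalk_arcs (P @ [a]))"
  proof -
    have "P @ [a] = ?z # tl (P @ [a])" using ab(1) by (cases P) auto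
    then show ?thesis
      using vwalk_arcs_join[of "b # Q" ?z "tl (P @ [a])"] by (simp only: append_Cons append_assoc)
  qed
  moreover have "xs @ [?z] = P @ a # A @ b # Q @ [?z]" using ab(1) by simp
  ultimately have "set (vwalk_arcs (xs @ [?z])) =
      set (vwalk_arcs (a # A @ [b])) \<union> set (vwalk_arcs (b # (Q @ P) @ [a]))"
    by (simp only: Un_ac)
  then have "parcs G = ?E1 \<union> ?E2" unfolding xs(3) symcl_Un[symmetric] by (rule arg_cong)
  moreover have "injects V (?E1 \<union> ?E2) u v T D"
  proof (rule injects_parallel)
    show "?E1 \<subseteq> set (a # A @ [b]) \<times> set (a # A @ [b])"
      "?E2 \<subseteq> set (b # (Q @ P) @ [a]) \<times> set (b # (Q @ P) @ [a])"
      by (rule symcl_vwalk_arcs_subset)+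
    show "set (a # A @ [b]) \<inter> set (b # (Q @ P) @ [a]) \<subseteq> {u, v}"
      using xs(1) ab by auto
    show "u \<in> set (a # A @ [b])" "v \<in> set (a # A @ [b])"
      "u \<in> set (b # (Q @ P) @ [a])" "v \<in> set (b # (Q @ P) @ [a])"
      using ab(2) by auto
    show "u \<noteq> v" by fact
    show "\<exists>F. cut ?E1 T u v F" if "T \<inter> set (a # A @ [b]) \<noteq> {}"
      using that xs(1) ab uv by (intro cut_arc') auto
    show "\<exists>F. cut ?E2 T u v F" if "T \<inter> set (b # (Q @ P) @ [a]) \<noteq> {}"
      using that xs(1) ab uv by (intro cut_arc') auto
  qed
  ultimately show ?thesis by simp
qed

section \<open>Wheels\<close>

text \<open>Up to the first change of layer the walk stays in layer \<open>a\<close>, and the vertex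
  where that change happens is a post.\<close>

lemma conn_reaches_post:
  assumes "conn E S u a x i" "S \<subseteq> V \<times> {0, 1}"
  shows "(\<exists>t \<in> posts S. conn E (S \<inter> UNIV \<times> {a}) u a t a) \<or>
    i = a \<and> conn E (S \<inter> UNIV \<times> {a}) u a x a"
  using assms(1)
proof (induction rule: conn.induct)
  case base
  then show ?case by (auto intro: conn.base)
next
  case (along x i y)
  then show ?case by (auto intro: conn.along)
next
  case (across x i j)
  have "x \<in> posts S" if "i = a" "j \<noteq> a"
    using that layer_cases[OF assms(2)] across.hyps(2) conn_end[OF across.hyps(1)]
    by (auto simp: posts_def)
  then show ?case using across.IH by blast
qed

text \<open>Elements that stay have images in \<open>A\<close>, while those that move land outside
  \<open>A\<close>; on the latter the involution is injective.\<close>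

lemma inj_on_involution_choice:
  assumes "\<And>x. x \<in> A \<Longrightarrow> \<phi> (\<phi> x) = x"
  shows "inj_on (\<lambda>x. if P x \<or> \<phi> x \<in> A then x else \<phi> x) A"
proof (rule inj_onI)
  fix x y
  assume A: "x \<in> A" "y \<in> A"
    and eq: "(if P x \<or> \<phi> x \<in> A then x else \<phi> x) = (if P y \<or> \<phi> y \<in> A then y else \<phi> y)"
  have "\<phi> x \<noteq> y" if "\<phi> x \<notin> A" using that A(2) by metis
  moreover have "\<phi> y \<noteq> x" if "\<phi> y \<notin> A" using that A(1) by metis
  moreover have "x = y" if "\<phi> x = \<phi> y" using arg_cong[OF that, of \<phi>] A assms by simp
  ultimately show "x = y" using eq by presburger
qed

lemma injects_hub:
  assumes sym: "sym E" and hub: "\<And>x. x \<in> V \<Longrightarrow> x \<noteq> h \<Longrightarrow> (h, x) \<in> E"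
    and uv: "u \<noteq> v" "u \<noteq> h" "v \<noteq> h"
    and T: "u \<notin> T" "v \<notin> T" "h \<notin> T" and D: "h \<in> D"
  shows "injects V E u v T D"
proof -
  let ?B = "joining V E u v 1 T D"
  \<comment> \<open>This swap moves the hub to the other layer but leaves both endpoints in
    place.\<close>
  define \<phi> :: "('a \<times> nat) set \<Rightarrow> ('a \<times> nat) set" where "\<phi> = flip (- {u, v})"
  \<comment> \<open>The swap is made only when it brings the hub to layer 0 without hitting another
    member of \<open>?B\<close>; this keeps \<open>k\<close> injective.\<close>
  define k where "k S = (if (h, 0) \<in> S \<or> \<phi> S \<in> ?B then S else \<phi> S)" for S
  have B: "S \<subseteq> V \<times> {0, 1}" "conn E S u 0 v 1" "posts S = T" "fst ` S = D" if "S \<in> ?B" for S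
    using that by (auto simp: joining_def)
  have ends: "(u, 0) \<in> S" "(v, 1) \<in> S" "(u, 1) \<notin> S" "(v, 0) \<notin> S" if "S \<in> ?B" for S
    using conn_start[OF B(2)[OF that]] conn_end[OF B(2)[OF that]] T(1,2) B(3)[OF that]
    by (auto simp: posts_def)
  have hub_layer: "(h, 0) \<in> S \<longleftrightarrow> (h, 1) \<notin> S" if S: "S \<in> ?B" for S
  proof -
    obtain i where "(h, i) \<in> S" using D B(4)[OF S] by force
    then show ?thesis
      using layer_cases[OF B(1)[OF S]] T(3) B(3)[OF S] by (auto simp: posts_def)
  qed
  have hub': "(x, h) \<in> E" if "x \<in> V" "x \<noteq> h" for x
    using hub[OF that] sym by (auto dest: symD)
  have via_hub: "conn E R u 0 v 0"
    if "R \<subseteq> V \<times> {0, 1}" "(u, 0) \<in> R" "(v, 0) \<in> R" "(h, 0) \<in> R" for R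
  proof -
    have "conn E R u 0 h 0" using that hub'[of u] uv by (auto intro: conn.base conn.along)
    moreover have "(h, v) \<in> E" using that hub[of v] uv by auto
    ultimately show ?thesis using that(3) by (rule conn.along)
  qed
  have k_class: "k S \<subseteq> V \<times> {0, 1} \<and> posts (k S) = T \<and> fst ` k S = D" if "S \<in> ?B" for S
    using B[OF that] flip_subset[OF B(1)[OF that]] support_flip[OF B(1)[OF that]]
    by (simp add: k_def \<phi>_def)
  then have k_flip: "flip {v} (k S) \<subseteq> V \<times> {0, 1}" if "S \<in> ?B" for S
    using that by (intro flip_subset) blast
  have good: "conn E (flip {v} (k S)) u 0 v 0" if S: "S \<in> ?B" for S
  proof -
    note [simp] = uv uv[symmetric]
    consider "(h, 0) \<in> S" | "(h, 1) \<in> S" "\<phi> S \<notin> ?B" | "(h, 1) \<in> S" "\<phi> S \<in> ?B"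
      using hub_layer[OF S] by blast
    then show ?thesis
    proof cases
      case 1
      then show ?thesis
        using ends[OF S] by (intro via_hub k_flip[OF S]) (auto simp: k_def flip_def)
    next
      case 2
      then have "k S = \<phi> S" using hub_layer[OF S] by (simp add: k_def)
      then show ?thesis
        using 2 ends[OF S] by (intro via_hub k_flip[OF S]) (auto simp: \<phi>_def flip_def)
    next
      case 3
      let ?R = "flip {v} S"
      have R: "?R \<subseteq> V \<times> {0, 1}" "posts ?R = T" using flip_subset[OF B(1)[OF S]] B(3)[OF S] by auto
      have h1: "(h, 1) \<in> ?R" using 3 by (simp add: flip_def)
      \<comment> \<open>The connection starts in layer 0 and ends in layer 1, so it first reaches a
        post inside layer 0.\<close>
      obtain t where t: "t \<in> T" "conn E (S \<inter> UNIV \<times> {0}) u 0 t 0"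
        using conn_reaches_post[OF B(2,1)[OF S]] B(3)[OF S] by auto
      have "conn E ?R u 0 t 0"
        using t(2) by (rule conn_mono) (use ends[OF S] in \<open>auto simp: flip_def\<close>)
      then have ut: "conn E ?R u 0 t 1"
        by (rule conn.across) (use t(1) R(2) in \<open>auto simp: posts_def\<close>)
      \<comment> \<open>The same argument, applied to the reversed connection in
        \<open>\<phi> S\<close>, yields a post reached from \<open>v\<close> inside layer 1.\<close>
      obtain s where s: "s \<in> T" "conn E (\<phi> S \<inter> UNIV \<times> {1}) v 1 s 1"
        using conn_reaches_post[OF conn_sym[OF B(2)[OF 3(2)] sym] B(1)[OF 3(2)]] B(3)[OF 3(2)] by auto
      \<comment> \<open>Away from \<open>u\<close> and \<open>v\<close>, layer 1 of
        \<open>\<phi> S\<close> is layer 0 of \<open>S\<close>; \<open>u\<close> has no copy in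
        layer 1, and \<open>v\<close> is brought down by \<open>flip {v}\<close>. Thus the piece of
        walk reappears in layer 0 of \<open>?R\<close>.\<close>
      have "conn E ?R v 0 s 0"
        using s(2) by (rule conn_project)
          (use ends[OF S] in \<open>auto simp: flip_def \<phi>_def split: if_splits\<close>)
      then have vs: "conn E ?R v 0 s 1"
        by (rule conn.across) (use s(1) R(2) in \<open>auto simp: posts_def\<close>)
      have ts: "t \<in> V" "s \<in> V" "t \<noteq> h" "s \<noteq> h" "(s, 1) \<in> ?R"
        using t(1) s(1) T(3) R by (auto simp: posts_def)
      \<comment> \<open>The two posts are linked through the hub in layer 1.\<close>
      have "conn E ?R u 0 s 1"
        using conn.along[OF conn.along[OF ut hub'[OF ts(1,3)] h1] hub[OF ts(2,4)] ts(5)] .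
      with conn_sym[OF vs sym] have "conn E ?R u 0 v 0" by (rule conn_trans)
      then show ?thesis using 3 by (simp add: k_def)
    qed
  qed
  have "inj_on k ?B"
    unfolding k_def by (rule inj_on_involution_choice) (use flip_flip[OF B(1)] in \<open>auto simp: \<phi>_def\<close>)
  moreover have "inj_on (flip {v}) (k ` ?B)"
    by (rule inj_on_subset[OF inj_on_flip[where V = V]]) (use k_class in blast)
  ultimately have "inj_on (flip {v} \<circ> k) ?B" by (rule comp_inj_on)
  moreover have "(flip {v} \<circ> k) ` ?B \<subseteq> joining V E u v 0 T D"
  proof safe
    fix S assume S: "S \<in> ?B"
    then have "k S \<subseteq> V \<times> {0, 1}" using k_class by blast
    from flip_subset[OF this] support_flip[OF this] good[OF S] k_class[OF S]
    show "(flip {v} \<circ> k) S \<in> joining V E u v 0 T D" by (simp add: joining_def)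
  qed
  ultimately show ?thesis unfolding injects_def by blast
qed

text \<open>Moving \<open>v\<close> alone to layer 0 places it next to the copy of \<open>u\<close>
  there.\<close>

lemma injects_adjacent:
  assumes "(u, v) \<in> E" "u \<noteq> v"
  shows "injects V E u v T D"
proof (rule injects_by_flip[of _ _ _ _ _ _ "{v}"])
  fix S assume "S \<in> joining V E u v 1 T D"
  then have "conn E S u 0 v 1" by (simp add: joining_def)
  from conn_start[OF this] conn_end[OF this] assms
  have "(u, 0) \<in> flip {v} S" "(v, 0) \<in> flip {v} S" by (auto simp: flip_def)
  with assms(1) show "conn E (flip {v} S) u 0 v 0" by (auto intro: conn.base conn.along)
qed

lemma injects_wheel:
  assumes "is_wheel_graph G" "u \<in> pverts G" "v \<in> pverts G"
  shows "injects (pverts G) (parcs G) u v T D"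
proof -
  obtain C h where C: "is_cycle_graph C" "h \<notin> pverts C" "pverts G = insert h (pverts C)"
    "parcs G = parcs C \<union> symcl ({h} \<times> pverts C)"
    using assms(1) unfolding is_wheel_graph_def by blast
  let ?V = "pverts G" and ?E = "parcs G"
  have hub: "(h, x) \<in> ?E" "(x, h) \<in> ?E" if "x \<in> ?V" "x \<noteq> h" for x
    using that C by (auto simp: symcl_iff)
  interpret pair_graph G using assms(1) by (rule pair_graph_wheel)
  have sym: "sym ?E" using arcs_symmetric by (auto intro: symI)
  show ?thesis
  proof (cases "u = v \<or> u = h \<or> v = h")
    case True
    then show ?thesis using injects_refl injects_adjacent hub assms(2,3) by metis
  next
    case False
    then have uv: "u \<noteq> v" "u \<noteq> h" "v \<noteq> h" by auto
    consider "u \<in> T" | "v \<in> T" | "h \<notin> D" | "h \<in> T" | "u \<notin> T" "v \<notin> T" "h \<in> D" "h \<notin> T" by blast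
    then show ?thesis
    proof cases
      case 1
      \<comment> \<open>Every edge leaving this set ends at the post \<open>u\<close>.\<close>
      then show ?thesis using uv by (intro injects_by_cut[of _ _ _ _ "- {u}"]) (auto simp: cut_def)
    next
      case 2
      then show ?thesis using uv by (intro injects_by_cut[of _ _ _ _ "{v}"]) (auto simp: cut_def)
    next
      case 3
      \<comment> \<open>With the hub absent only rim edges can be used, so the class is that of the
        cycle.\<close>
      have "conn ?E S u 0 v j \<longleftrightarrow> conn (parcs C) S u 0 v j" if "fst ` S = D" for S j
      proof
        assume "conn ?E S u 0 v j"
        then show "conn (parcs C) S u 0 v j"
        proof (rule conn_restrict_edges)
          fix x y i j assume "(x, y) \<in> ?E" "(x, i) \<in> S" "(y, j) \<in> S"
          moreover from this have "x \<noteq> h" "y \<noteq> h" using that 3 by force+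
          ultimately show "(x, y) \<in> parcs C" using C(4) by (auto simp: symcl_iff)
        qed
      next
        assume "conn (parcs C) S u 0 v j"
        then show "conn ?E S u 0 v j" by (rule conn_mono_edges) (use C(4) in auto)
      qed
      then have "joining ?V ?E u v j T D = joining ?V (parcs C) u v j T D" for j
        unfolding joining_def by blast
      moreover have "injects ?V (parcs C) u v T D"
        using injects_cycle[OF C(1)] assms(2,3) C(3) uv by auto
      ultimately show ?thesis unfolding injects_def by simp
    next
      case 4
      show ?thesis
      \<comment> \<open>The hub keeps its copy in layer 0, through which \<open>u\<close> and the
        moved \<open>v\<close> are joined.\<close>
      proof (rule injects_by_flip[of _ _ _ _ _ _ "{v}"])
        fix S assume S: "S \<in> joining ?V ?E u v 1 T D"
        then have "conn ?E S u 0 v 1" "h \<in> posts S" using 4 by (auto simp: joining_def)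
        with conn_start[OF this(1)] conn_end[OF this(1)] uv
        have "(u, 0) \<in> flip {v} S" "(h, 0) \<in> flip {v} S" "(v, 0) \<in> flip {v} S"
          by (auto simp: flip_def posts_def)
        then show "conn ?E (flip {v} S) u 0 v 0"
          using hub[OF assms(2) uv(2)] hub[OF assms(3) uv(3)] by (meson conn.base conn.along)
      qed
    next
      case 5
      then show ?thesis using uv by (intro injects_hub[OF sym, of _ h]) (auto intro: hub(1))
    qed
  qed
qed

section \<open>From cardinalities to probabilities\<close>

theorem theorem1p2:
  fixes G :: "'a pair_pre_digraph" and u v :: 'a
  assumes "is_path_graph G \<or> is_cycle_graph G \<or> is_wheel_graph G"
    and "u \<in> pverts G" and "v \<in> pverts G"
  shows "measure_pmf.prob (pmf_of_set (Pow (pverts (bunkbed G))))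
           {S. joined_within (bunkbed G) S (u, 0) (v, 0)}
       \<ge> measure_pmf.prob (pmf_of_set (Pow (pverts (bunkbed G))))
           {S. joined_within (bunkbed G) S (u, 0) (v, 1)}"
proof -
  have "pair_graph G"
    using assms(1) pair_graph_path pair_graph_cycle pair_graph_wheel by blast
  then interpret pair_graph G .
  let ?V = "pverts G"
  have inj: "injects ?V (parcs G) u v T D" for T D
    using assms injects_path injects_cycle injects_wheel by metis
  have verts: "pverts (bunkbed G) = ?V \<times> {0, 1}" by (simp add: bunkbed_def)
  \<comment> \<open>Under the uniform distribution both probabilities are such counts over the same
    denominator.\<close>
  have "Pow (?V \<times> {0, 1}) \<inter> {S. joined_within (bunkbed G) S (u, 0) (v, j)} =
      {S. S \<subseteq> ?V \<times> {0, 1} \<and> conn (parcs G) S u 0 v j}" for j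
    by (auto simp: joined_within_conv_conn)
  moreover have "finite (Pow (?V \<times> {0, 1::nat}))" "Pow (?V \<times> {0, 1::nat}) \<noteq> {}" by auto
  ultimately show ?thesis
    using card_joining_le[OF pair_finite_verts inj]
    by (simp add: verts measure_pmf_of_set divide_right_mono)
qed

end
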